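(* Let $P\subset\mathbb{R}^2$ be an arbitrary $2$-dimensional rational polygon. Then $|\mathrm{Q}_1(P,r)|\leq \mathrm{Q}_1(P,0)$ for all rational $0\leq r<\mathrm{q}(P)$.
   Context: For a rational polytope $P\subset\mathbb{R}^n$, let $\mathrm{G}_i(P,\cdot)$ be the unique periodic functions on $\mathbb{Z}_{\ge 0}$ with $\#(kP\cap\mathbb{Z}^n)=\sum_i\mathrm{G}_i(P,k)k^i$ for $k\in\mathbb{Z}_{\ge0}$. The rational Ehrhart coefficients are $\mathrm{Q}_i(P,a/b):=b^i\mathrm{G}_i(\tfrac1bP,a)$ for $a\in\mathbb{Z}_{\ge0}$, $b\in\mathbb{Z}_{>0}$; they are well defined, periodic, and $\#(rP\cap\mathbb{Z}^n)=\sum_i\mathrm{Q}_i(P,r)r^i$ for $r\in\mathbb{Q}_{\ge0}$. The rational denominator is $\mathrm{q}(P)=\min\{r\in\mathbb{Q}_{>0}: rP\text{ has all vertices in }\mathbb{Z}^n\}$. *)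

theory Defs
  imports "HOL-Analysis.Analysis"
begin

definition int_lattice :: "(real^'n) set" where
  "int_lattice = {x. \<forall>i. x $ i \<in> \<int>}"

definition rational_polytope :: "(real^'n) set \<Rightarrow> bool" where
  "rational_polytope P \<longleftrightarrow>
     polytope P \<and> (\<forall>v. v extreme_point_of P \<longrightarrow> (\<forall>i. v $ i \<in> \<rat>))"

definition lattice_count :: "(real^'n) set \<Rightarrow> real \<Rightarrow> nat" where
  "lattice_count P c = card ((*\<^sub>R) c ` P \<inter> int_lattice)"

text \<open>The coefficient index runs over \<open>0, \<dots>, n\<close>; the family is extended by zero
  beyond \<open>n\<close> so that it is unique as a function on all natural numbers.
  Note that \<open>0 ^ 0 = 1\<close>, matching the count of the dilate \<open>0 P = {0}\<close>.\<close>

definition is_ehrhart_coeffs :: "(real^'n) set \<Rightarrow> (nat \<Rightarrow> nat \<Rightarrow> real) \<Rightarrow> bool" where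
  "is_ehrhart_coeffs P G \<longleftrightarrow>
     (\<forall>i. \<exists>p>0. \<forall>k. G i (k + p) = G i k) \<and>
     (\<forall>i>CARD('n). \<forall>k. G i k = 0) \<and>
     (\<forall>k. real (lattice_count P (real k)) = (\<Sum>i\<le>CARD('n). G i k * real k ^ i))"

definition ehrhart_coeff :: "nat \<Rightarrow> (real^'n) set \<Rightarrow> nat \<Rightarrow> real" where
  "ehrhart_coeff i P = (THE G. is_ehrhart_coeffs P G) i"

text \<open>For a rational polytope the value \<open>b\<^sup>i G\<^sub>i(P/b, a)\<close> depends only on the quotient
  \<open>r = a/b\<close>; the representation in lowest terms is taken. Only \<open>r \<ge> 0\<close> is meaningful.\<close>

definition rat_ehrhart_coeff :: "nat \<Rightarrow> (real^'n) set \<Rightarrow> rat \<Rightarrow> real" where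
  "rat_ehrhart_coeff i P r =
     (let (a, b) = quotient_of r in
        real_of_int b ^ i * ehrhart_coeff i ((*\<^sub>R) (1 / real_of_int b) ` P) (nat a))"

definition rat_denominator :: "(real^'n) set \<Rightarrow> rat" where
  "rat_denominator P =
     (LEAST r. 0 < r \<and>
        (\<forall>v. v extreme_point_of ((*\<^sub>R) (real_of_rat r) ` P) \<longrightarrow> v \<in> int_lattice))"

end

theory Submission
  imports Defs
begin

text \<open>
  Lattice points are counted column by column. Over a vertical strip without vertices in its interior
  both the top \<open>u\<close> and the negated bottom \<open>w\<close> of the polygon are affine, and the sum of
  \<open>\<lfloor>\<alpha>x + k\<beta>\<rfloor> + 1/2\<close> over \<open>ka < x \<le> kb\<close>, where \<open>\<alpha> = p/q\<close> in lowest terms, has linear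
  coefficient \<open>(b - a) \<psi>(qk\<beta>) / q + \<psi>(kb) (\<alpha>b + \<beta>) - \<psi>(ka) (\<alpha>a + \<beta>)\<close> with
  \<open>\<psi>(t) = 1/2 - frac t\<close>. The end point terms telescope, so the linear Ehrhart coefficient is a sum
  over the edges of the nonnegative lattice length times a value of \<open>\<psi>\<close>. Since
  \<open>\<bar>\<psi>\<bar> \<le> 1/2 = \<psi>(0)\<close>, it is largest in absolute value at \<open>0\<close>. Rational dilates reduce to integer
  ones through \<open>G\<^sub>i(bP, k) = b\<^sup>i G\<^sub>i(P, bk)\<close>, which holds because the coefficients are unique.
\<close>

subsection \<open>Periodic functions and sums of fractional parts\<close>

definition periodic :: "(nat \<Rightarrow> 'a) \<Rightarrow> bool" where
  "periodic g \<longleftrightarrow> (\<exists>p>0. \<forall>k. g (k + p) = g k)"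

lemma periodic_const [simp]: "periodic (\<lambda>_. c)"
  by (auto simp: periodic_def intro: exI [of _ 1])

lemma periodic_add_mult:
  fixes g :: "nat \<Rightarrow> 'a"
  assumes "\<And>k. g (k + p) = g k"
  shows "g (k + n * p) = g k"
proof (induction n)
  case (Suc n)
  then show ?case using assms [of "k + n * p"] by (simp add: algebra_simps)
qed simp

text \<open>The product of the two periods serves as a common one. The combining function
  \<open>h\<close> is arbitrary, so with \<open>Pair\<close> several periodic functions can be
  bundled into one.\<close>

lemma periodic_comp2:
  assumes "periodic f" "periodic g"
  shows "periodic (\<lambda>k. h (f k) (g k))"
proof -
  obtain p q where "p > 0" "\<And>k. f (k + p) = f k" "q > 0" "\<And>k. g (k + q) = g k"
    using assms by (auto simp: periodic_def)
  then have "p * q > 0" "f (k + p * q) = f k" "g (k + p * q) = g k" for k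
    using periodic_add_mult [of f p k q] periodic_add_mult [of g q k p] by (auto simp: mult.commute)
  then show ?thesis
    unfolding periodic_def by (intro exI [of _ "p * q"]) simp
qed

lemma periodic_comp: "periodic f \<Longrightarrow> periodic (\<lambda>k. h (f k))"
  using periodic_comp2 [of f f "\<lambda>x _. h x"] by simp

lemma periodic_dilate:
  assumes "periodic g"
  shows "periodic (\<lambda>k. g (b * k))"
proof -
  obtain p where p: "p > 0" "\<And>k. g (k + p) = g k"
    using assms by (auto simp: periodic_def)
  then show ?thesis
    using periodic_add_mult [of g p _ b]
    unfolding periodic_def by (intro exI [of _ p]) (auto simp: distrib_left)
qed

lemma rat_mult_int_period:
  assumes "b \<in> \<rat>"
  obtains d where "d > 0" "real d * b \<in> \<int>"
proof -
  obtain i n where "n > 0" "b = of_int i / of_int n"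
    using Rats_cases' [OF assms] by metis
  then show ?thesis
    by (intro that [of "nat n"]) auto
qed

lemma periodic_frac:
  assumes "b \<in> \<rat>"
  shows "periodic (\<lambda>k. frac (real k * b))"
proof -
  obtain d where d: "d > 0" "real d * b \<in> \<int>"
    using rat_mult_int_period [OF assms] .
  then obtain i where "real d * b = of_int i"
    by (auto elim: Ints_cases)
  then have "frac (real (k + d) * b) = frac (real k * b)" for k
    by (simp add: distrib_right frac_def)
  with d show ?thesis
    by (auto simp: periodic_def)
qed

lemma periodic_floor_mod:
  assumes "b \<in> \<rat>" "q > 0"
  shows "periodic (\<lambda>k. \<lfloor>real k * b\<rfloor> mod q)"
proof -
  obtain d where d: "d > 0" "real d * b \<in> \<int>"
    using rat_mult_int_period [OF assms(1)] .
  then obtain i where i: "real d * b = of_int i"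
    by (auto elim: Ints_cases)
  have "real (k + d * nat q) * b = real k * b + of_int (i * q)" for k
  proof -
    have "real (k + d * nat q) * b = real k * b + of_int q * (real d * b)"
      using \<open>q > 0\<close> by (simp add: algebra_simps)
    then show ?thesis unfolding i by simp
  qed
  then have "\<lfloor>real (k + d * nat q) * b\<rfloor> mod q = \<lfloor>real k * b\<rfloor> mod q" for k
    by (simp only: floor_add_int [symmetric]) simp
  moreover have "d * nat q > 0"
    using d assms by simp
  ultimately show ?thesis
    unfolding periodic_def by blast
qed

text \<open>The property wanted of the linear coefficient. It survives addition, so the contribution
  of each edge can be treated separately.\<close>

definition balanced :: "(nat \<Rightarrow> real) \<Rightarrow> bool" where
  "balanced g \<longleftrightarrow> periodic g \<and> (\<forall>k. \<bar>g k\<bar> \<le> g 0)"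

lemma balanced_add: "balanced f \<Longrightarrow> balanced g \<Longrightarrow> balanced (\<lambda>k. f k + g k)"
  unfolding balanced_def
proof (elim conjE, intro conjI allI)
  fix k
  assume "\<forall>k. \<bar>f k\<bar> \<le> f 0" "\<forall>k. \<bar>g k\<bar> \<le> g 0"
  then have "\<bar>f k\<bar> \<le> f 0" "\<bar>g k\<bar> \<le> g 0" by blast+
  then show "\<bar>f k + g k\<bar> \<le> f 0 + g 0" by linarith
qed (rule periodic_comp2)

text \<open>The value at integers is the maximum 1/2, not the 0 of the odd sawtooth function; this
  is why the argument 0 dominates all others in absolute value.\<close>

definition sawtooth :: "real \<Rightarrow> real" where
  "sawtooth t = 1 / 2 - frac t"

lemma abs_sawtooth_le: "\<bar>sawtooth t\<bar> \<le> 1 / 2"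
  using frac_ge_0 [of t] frac_lt_1 [of t] by (auto simp: sawtooth_def abs_if)

lemma sawtooth_0 [simp]: "sawtooth 0 = 1 / 2"
  by (simp add: sawtooth_def)

lemma floor_eq_sawtooth: "real_of_int \<lfloor>t\<rfloor> = t + sawtooth t - 1 / 2"
  by (simp add: sawtooth_def frac_def)

text \<open>\<open>sawtooth\<close> fails to be odd exactly at the integers. This defect accounts
  for the column at the left end of the polygon.\<close>

lemma sawtooth_minus: "sawtooth (- t) = (if t \<in> \<int> then 1 else 0) - sawtooth t"
  by (simp add: sawtooth_def frac_neg)

lemma periodic_sawtooth: "b \<in> \<rat> \<Longrightarrow> periodic (\<lambda>k. sawtooth (real k * b))"
  unfolding sawtooth_def by (rule periodic_comp [OF periodic_frac])

text \<open>Each summand is the mean \<open>s\<close> plus an increment of \<open>\<theta>\<close>,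
  which measures how far a partial sum over residues deviates from its mean growth; the increments
  telescope.\<close>

lemma sum_periodic_int:
  fixes \<phi> :: "int \<Rightarrow> real" and q :: int
  assumes per: "\<And>x. \<phi> (x + q) = \<phi> x" and q: "q > 0" and "m \<le> n"
  defines "s \<equiv> (\<Sum>x\<in>{0..<q}. \<phi> x) / of_int q"
  defines "\<theta> \<equiv> \<lambda>j. (\<Sum>x\<in>{1..j}. \<phi> x) - of_int j * s"
  shows "(\<Sum>x\<in>{m+1..n}. \<phi> x) = of_int (n - m) * s + \<theta> (n mod q) - \<theta> (m mod q)"
  using \<open>m \<le> n\<close>
proof (induction n rule: int_ge_induct)
  case base
  then show ?case by simp
next
  case (step n)
  have "\<phi> (x + int k * q) = \<phi> x" for x k
  proof (induction k)
    case (Suc k)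
    have "\<phi> (x + int (Suc k) * q) = \<phi> ((x + int k * q) + q)" by (simp add: algebra_simps)
    with Suc per show ?case by simp
  qed simp
  note shift = this
  have mod: "\<phi> x = \<phi> (x mod q)" for x
  proof (cases "x div q \<ge> 0")
    case True
    then show ?thesis using shift [of "x mod q" "nat (x div q)"] by simp
  next
    case False
    \<comment> \<open>\<open>shift\<close> only goes upwards, so for a negative quotient it is
      applied from \<open>x\<close> to its residue.\<close>
    have e: "x mod q = x + - (x div q) * q" by (simp add: minus_div_mult_eq_mod [symmetric])
    show ?thesis using shift [of x "nat (- (x div q))"] False unfolding e by simp
  qed
  define j where "j = n mod q"
  have j: "0 \<le> j" "j < q" using q by (auto simp: j_def)
  have "\<phi> (n + 1) = \<phi> (j + 1)"
    using mod [of "n + 1"] mod [of "j + 1"] by (simp add: j_def mod_add_left_eq)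
  moreover have "\<phi> (j + 1) = s + \<theta> ((n + 1) mod q) - \<theta> j"
  proof (cases "j + 1 = q")
    \<comment> \<open>At the wrap-around the residue drops to 0, where \<open>\<theta>\<close>
      vanishes, and one complete period with sum \<open>q * s\<close> has been collected.\<close>
    case True
    then have "(n + 1) mod q = 0"
      unfolding j_def by (metis mod_add_left_eq mod_self)
    have "{0..<q} = insert 0 {1..j}" using True q by auto
    then have "of_int q * s = \<phi> 0 + (\<Sum>x\<in>{1..j}. \<phi> x)"
      using q by (simp add: s_def)
    moreover have "\<phi> (j + 1) = \<phi> 0" using True per [of 0] by simp
    moreover have "of_int q = real_of_int j + 1" using True by auto
    ultimately show ?thesis
      using \<open>(n + 1) mod q = 0\<close> by (simp add: \<theta>_def algebra_simps)
  next
    case False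
    have "(n + 1) mod q = (j + 1) mod q" by (simp add: j_def mod_add_left_eq)
    with False j have "(n + 1) mod q = j + 1" by simp
    moreover have "{1..j+1} = insert (j+1) {1..j}" using j by auto
    ultimately show ?thesis unfolding \<theta>_def by (simp add: algebra_simps)
  qed
  moreover have "{m+1..n+1} = insert (n+1) {m+1..n}" using step by auto
  ultimately show ?case using step.IH by (simp add: j_def algebra_simps)
qed

lemma sum_real_lessThan: "(\<Sum>x\<in>{0..<n}. real x) = real n * (real n - 1) / 2"
  by (induction n) (auto simp: field_simps)

text \<open>For \<open>i = \<lfloor>qy\<rfloor>\<close> the fractional parts are \<open>((px + i) mod q + frac (qy)) / q\<close>, and
  \<open>(px + i) mod q\<close> runs through all residues.\<close>

lemma sum_sawtooth_residues:
  fixes p q :: int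
  assumes "coprime p q" and q: "q > 0"
  shows "(\<Sum>x\<in>{0..<q}. sawtooth (of_int p / of_int q * of_int x + y)) = sawtooth (of_int q * y)"
proof -
  define i where "i = \<lfloor>of_int q * y\<rfloor>"
  define e where "e = frac (of_int q * y)"
  have y: "y = (of_int i + e) / of_int q"
    using q by (simp add: i_def e_def frac_def)
  have e: "0 \<le> e" "e < 1" by (auto simp: e_def frac_lt_1)
  have frac: "frac (of_int p / of_int q * of_int x + y) = (of_int ((p * x + i) mod q) + e) / of_int q"
    (is "_ = ?r") for x
  proof -
    have "real_of_int (p * x + i) = of_int ((p * x + i) div q * q + (p * x + i) mod q)"
      by (simp only: div_mult_mod_eq)
    then have "of_int p * of_int x + real_of_int i - of_int ((p * x + i) mod q) =
        of_int ((p * x + i) div q) * of_int q"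
      unfolding of_int_add of_int_mult by linarith
    \<comment> \<open>The candidate \<open>?r\<close> differs from the argument by an integer and
      lies in [0, 1), so it is the fractional part.\<close>
    moreover have "of_int p / of_int q * of_int x + y - ?r =
        (of_int p * of_int x + of_int i - of_int ((p * x + i) mod q)) / of_int q"
      unfolding y by (simp add: add_divide_distrib diff_divide_distrib)
    ultimately have "of_int p / of_int q * of_int x + y - ?r = of_int ((p * x + i) div q)"
      using q by simp
    moreover have "0 \<le> ?r" using e q by simp
    moreover have "?r < 1"
    proof -
      have "(p * x + i) mod q + 1 \<le> q" using q by (simp add: add1_zle_eq)
      then have "real_of_int ((p * x + i) mod q) + 1 \<le> of_int q" by linarith
      with e q show ?thesis by (simp add: divide_less_eq)
    qed
    ultimately show ?thesis
      by (simp add: frac_unique_iff)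
  qed
  have inj: "inj_on (\<lambda>x. (p * x + i) mod q) {0..<q}"
  proof (rule inj_onI)
    fix x z assume x: "x \<in> {0..<q}" and z: "z \<in> {0..<q}" and "(p * x + i) mod q = (p * z + i) mod q"
    then have "q dvd p * (x - z)"
      by (simp add: mod_eq_dvd_iff algebra_simps)
    then have "q dvd x - z"
      using assms by (simp add: coprime_commute coprime_dvd_mult_right_iff)
    then show "x = z"
      using x z by (metis atLeastLessThan_iff mod_eq_dvd_iff mod_pos_pos_trivial)
  qed
  moreover have "(\<lambda>x. (p * x + i) mod q) ` {0..<q} \<subseteq> {0..<q}" using q by auto
  ultimately have "(\<lambda>x. (p * x + i) mod q) ` {0..<q} = {0..<q}"
    by (simp add: endo_inj_surj)
  then have "(\<Sum>x\<in>{0..<q}. real_of_int ((p * x + i) mod q)) = (\<Sum>x\<in>{0..<q}. real_of_int x)"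
    using sum.reindex [OF inj, of real_of_int] by simp
  also have "\<dots> = of_int q * (of_int q - 1) / 2"
  proof -
    have "(\<Sum>x\<in>{0..<q}. real_of_int x) = (\<Sum>x\<in>{0..<nat q}. real x)"
      by (rule sum.reindex_bij_witness [of _ int nat]) auto
    also have "\<dots> = real (nat q) * (real (nat q) - 1) / 2"
      by (rule sum_real_lessThan)
    finally show ?thesis using q by simp
  qed
  finally have "(\<Sum>x\<in>{0..<q}. (of_int ((p * x + i) mod q) + e) / of_int q) = (of_int q - 1) / 2 + e"
    using q by (simp add: sum_divide_distrib [symmetric] sum.distrib add_divide_distrib)
  \<comment> \<open>What remains is q/2 - ((q - 1)/2 + e) = 1/2 - e, the sawtooth at
    \<open>of_int q * y\<close>.\<close>
  then show ?thesis
    using q unfolding sawtooth_def frac sum_subtractf e_def [symmetric]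
    by (simp add: diff_divide_distrib)
qed

section \<open>Floor sums over strips with affine and piecewise affine boundary\<close>

lemma sum_int_interval_affine:
  fixes m n :: int and \<alpha> \<gamma> :: real
  assumes "m \<le> n"
  shows "(\<Sum>x\<in>{m+1..n}. \<alpha> * of_int x + \<gamma>) =
    \<alpha> / 2 * (of_int n * (of_int n + 1) - of_int m * (of_int m + 1)) + \<gamma> * (of_int n - of_int m)"
  using assms
proof (induction n rule: int_ge_induct)
  case (step n)
  have "{m+1..n+1} = insert (n+1) {m+1..n}" using step by auto
  then have "(\<Sum>x\<in>{m+1..n+1}. \<alpha> * of_int x + \<gamma>) =
      \<alpha> * of_int (n + 1) + \<gamma> + (\<Sum>x\<in>{m+1..n}. \<alpha> * of_int x + \<gamma>)" by simp
  also have "\<dots> = \<alpha> / 2 * (of_int (n+1) * (of_int (n+1) + 1) - of_int m * (of_int m + 1))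
      + \<gamma> * (of_int (n+1) - of_int m)"
    unfolding step.IH by (simp add: algebra_simps add_divide_distrib)
  finally show ?case .
qed simp

text \<open>The floor plus 1/2 is the argument plus its \<open>sawtooth\<close>. The affine part is
  an arithmetic series in which n(n + 1) = (n + 1/2)^2 - 1/4 with n + 1/2 = kb + sawtooth(kb), which
  yields the end point terms; the sawtooth part is n - m times its mean, up to a periodic
  error.\<close>

lemma slab_sum:
  fixes \<alpha> \<beta> a b :: real
  assumes rat: "\<alpha> \<in> \<rat>" "\<beta> \<in> \<rat>" "a \<in> \<rat>" "b \<in> \<rat>" and "a \<le> b"
  shows "\<exists>A g g\<^sub>0. balanced g \<and> periodic g\<^sub>0 \<and>
    (\<forall>k. (\<Sum>x\<in>{\<lfloor>real k * a\<rfloor> + 1..\<lfloor>real k * b\<rfloor>}. of_int \<lfloor>\<alpha> * of_int x + real k * \<beta>\<rfloor> + 1 / 2) =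
      A * (real k)\<^sup>2 + (g k + sawtooth (real k * b) * (\<alpha> * b + \<beta>)
        - sawtooth (real k * a) * (\<alpha> * a + \<beta>)) * real k + g\<^sub>0 k)"
proof -
  obtain p q where pq: "q > 0" "coprime p q" "\<alpha> = of_int p / of_int q"
    using Rats_cases' [OF rat(1)] by metis
  define \<phi> where "\<phi> y x = sawtooth (\<alpha> * of_int x + y)" for y :: real and x :: int
  \<comment> \<open>By \<open>sum_sawtooth_residues\<close> this is the mean of
    \<open>\<phi> y\<close> over a period; \<open>\<theta>\<close> is the matching
    deviation.\<close>
  define s where "s y = sawtooth (of_int q * y) / of_int q" for y :: real
  define \<theta> where "\<theta> y j = (\<Sum>x\<in>{1..j}. \<phi> y x) - of_int j * s y" for y :: real and j :: int
  \<comment> \<open>The sawtooth sees only the fractional part of k\<beta>. That part is periodic in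
    \<open>k\<close>, hence so is everything computed from it.\<close>
  define y where "y k = frac (real k * \<beta>)" for k
  define \<sigma> where "\<sigma> c k = sawtooth (real k * c)" for c k
  define R where "R c k = \<lfloor>real k * c\<rfloor> mod q" for c k
  define g where "g k = s (y k) * (b - a)" for k
  define g\<^sub>0 where "g\<^sub>0 k = \<alpha> / 2 * ((\<sigma> b k)\<^sup>2 - (\<sigma> a k)\<^sup>2) + s (y k) * (\<sigma> b k - \<sigma> a k)
    + (\<theta> (y k) (R b k) - \<theta> (y k) (R a k))" for k
  have y: "periodic y"
    unfolding y_def by (rule periodic_frac [OF rat(2)])
  have \<sigma>: "periodic (\<sigma> a)" "periodic (\<sigma> b)"
    unfolding \<sigma>_def by (intro periodic_sawtooth rat)+
  have R: "periodic (R a)" "periodic (R b)"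
    unfolding R_def by (intro periodic_floor_mod rat pq)+
  have "periodic g"
    unfolding g_def by (rule periodic_comp [OF y])
  moreover have "\<bar>g k\<bar> \<le> g 0" for k
  proof -
    \<comment> \<open>Since \<open>y 0 = 0\<close>, the right side is 1/(2q), the largest value of
      \<open>s\<close>.\<close>
    have "\<bar>s (y k)\<bar> \<le> s (y 0)"
      using divide_right_mono [OF abs_sawtooth_le, of "of_int q" "of_int q * y k"] pq
      by (simp add: s_def y_def)
    then show ?thesis
      using \<open>a \<le> b\<close> by (simp add: g_def abs_mult mult_right_mono)
  qed
  ultimately have "balanced g" by (simp add: balanced_def)
  moreover have "periodic g\<^sub>0"
  proof -
    have "periodic (\<lambda>k. (\<sigma> a k, \<sigma> b k))" "periodic (\<lambda>k. (R a k, R b k))"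
      using periodic_comp2 [OF \<sigma>, of Pair] periodic_comp2 [OF R, of Pair] by auto
    from periodic_comp2 [OF y periodic_comp2 [OF this, of Pair], of
      "\<lambda>y ((\<sigma>a, \<sigma>b), (ra, rb)). \<alpha> / 2 * (\<sigma>b\<^sup>2 - \<sigma>a\<^sup>2) + s y * (\<sigma>b - \<sigma>a) + (\<theta> y rb - \<theta> y ra)"]
    show ?thesis unfolding g\<^sub>0_def by simp
  qed
  moreover have "(\<Sum>x\<in>{\<lfloor>real k * a\<rfloor> + 1..\<lfloor>real k * b\<rfloor>}. of_int \<lfloor>\<alpha> * of_int x + real k * \<beta>\<rfloor> + 1 / 2) =
      (\<alpha> / 2 * (b\<^sup>2 - a\<^sup>2) + \<beta> * (b - a)) * (real k)\<^sup>2 + (g k + \<sigma> b k * (\<alpha> * b + \<beta>)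
        - \<sigma> a k * (\<alpha> * a + \<beta>)) * real k + g\<^sub>0 k" for k
  proof -
    define m n where "m = \<lfloor>real k * a\<rfloor>" and "n = \<lfloor>real k * b\<rfloor>"
    have "m \<le> n"
      unfolding m_def n_def using \<open>a \<le> b\<close> by (intro floor_mono mult_left_mono) auto
    have m: "real_of_int m = real k * a + \<sigma> a k - 1 / 2" and n: "real_of_int n = real k * b + \<sigma> b k - 1 / 2"
      by (simp_all add: m_def n_def \<sigma>_def floor_eq_sawtooth)
    have shift: "sawtooth (t + of_int i) = sawtooth t" for t i
      by (simp add: sawtooth_def frac_def)
    have "\<phi> (y k) x = sawtooth (\<alpha> * of_int x + real k * \<beta>)" for x
      using shift [of "\<alpha> * of_int x + y k" "\<lfloor>real k * \<beta>\<rfloor>"] by (simp add: \<phi>_def y_def frac_def)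
    then have "(\<Sum>x\<in>{m+1..n}. of_int \<lfloor>\<alpha> * of_int x + real k * \<beta>\<rfloor> + 1 / 2) =
      (\<Sum>x\<in>{m+1..n}. \<alpha> * of_int x + real k * \<beta>) + (\<Sum>x\<in>{m+1..n}. \<phi> (y k) x)"
      by (simp add: floor_eq_sawtooth flip: sum.distrib)
    moreover have "(\<Sum>x\<in>{m+1..n}. \<phi> (y k) x) =
      of_int (n - m) * s (y k) + \<theta> (y k) (n mod q) - \<theta> (y k) (m mod q)"
    proof -
      have "\<phi> (y k) (x + q) = \<phi> (y k) x" for x
        using shift [of "\<alpha> * of_int x + y k" p] pq
        by (simp add: \<phi>_def distrib_left add_divide_distrib add_ac)
      from sum_periodic_int [where \<phi> = "\<phi> (y k)", OF this \<open>q > 0\<close> \<open>m \<le> n\<close>]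
      show ?thesis
        using sum_sawtooth_residues [OF pq(2,1), of "y k"] by (simp add: \<theta>_def s_def \<phi>_def pq(3))
    qed
    ultimately have "(\<Sum>x\<in>{m+1..n}. of_int \<lfloor>\<alpha> * of_int x + real k * \<beta>\<rfloor> + 1 / 2) =
        \<alpha> / 2 * (of_int n * (of_int n + 1) - of_int m * (of_int m + 1))
        + real k * \<beta> * (of_int n - of_int m) + (of_int n - of_int m) * s (y k)
        + (\<theta> (y k) (R b k) - \<theta> (y k) (R a k))"
      unfolding sum_int_interval_affine [OF \<open>m \<le> n\<close>] of_int_diff R_def
        m_def [symmetric] n_def [symmetric] by linarith
    also have "\<dots> = (\<alpha> / 2 * (b\<^sup>2 - a\<^sup>2) + \<beta> * (b - a)) * (real k)\<^sup>2 + (g k + \<sigma> b k * (\<alpha> * b + \<beta>)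
        - \<sigma> a k * (\<alpha> * a + \<beta>)) * real k + g\<^sub>0 k"
    proof -
      \<comment> \<open>Writing \<alpha> as \<open>2 * h\<close> clears the denominator of
        \<alpha>/2 before the polynomial identity is expanded.\<close>
      have "\<exists>h. \<alpha> = 2 * h" by (rule exI [of _ "\<alpha> / 2"]) simp
      then obtain h where h: "\<alpha> = 2 * h" ..
      then have h2: "\<alpha> / 2 = h" by simp
      show ?thesis
        unfolding m n g_def g\<^sub>0_def h2 h by (simp add: power2_eq_square algebra_simps)
    qed
    finally show ?thesis unfolding m_def n_def .
  qed
  ultimately show ?thesis
    unfolding \<sigma>_def by (intro exI conjI allI)
qed

text \<open>The half-open range lets adjacent strips be joined without overlap. A column of the
  dilate holds a floor for the top plus a floor for the negated bottom plus 1 lattice points; each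
  of the two boundaries takes one half of that 1.\<close>

definition edge_sum :: "(real \<Rightarrow> real) \<Rightarrow> real \<Rightarrow> real \<Rightarrow> nat \<Rightarrow> real" where
  "edge_sum u a b k =
     (\<Sum>x\<in>{\<lfloor>real k * a\<rfloor> + 1..\<lfloor>real k * b\<rfloor>}. of_int \<lfloor>real k * u (of_int x / real k)\<rfloor> + 1 / 2)"

text \<open>The two sawtooth terms are the end point contributions; they telescope over consecutive slabs.\<close>

definition edge_quasi :: "(real \<Rightarrow> real) \<Rightarrow> real \<Rightarrow> real \<Rightarrow> bool" where
  "edge_quasi u a b \<longleftrightarrow> (\<exists>A g g\<^sub>0. balanced g \<and> periodic g\<^sub>0 \<and>
     (\<forall>k. edge_sum u a b k = A * (real k)\<^sup>2 +
        (g k + sawtooth (real k * b) * u b - sawtooth (real k * a) * u a) * real k + g\<^sub>0 k))"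

lemma edge_quasi_refl: "edge_quasi u a a"
  unfolding edge_quasi_def edge_sum_def
  by (rule exI [of _ 0], rule exI [of _ "\<lambda>_. 0"], rule exI [of _ "\<lambda>_. 0"]) (simp add: balanced_def)

lemma edge_quasi_affine:
  assumes rat: "\<alpha> \<in> \<rat>" "\<beta> \<in> \<rat>" "a \<in> \<rat>" "b \<in> \<rat>" and "a \<le> b"
    and u: "\<And>x. a \<le> x \<Longrightarrow> x \<le> b \<Longrightarrow> u x = \<alpha> * x + \<beta>"
  shows "edge_quasi u a b"
proof -
  obtain A g g\<^sub>0 where g: "balanced g" "periodic g\<^sub>0" and
    eq: "\<And>k. (\<Sum>x\<in>{\<lfloor>real k * a\<rfloor> + 1..\<lfloor>real k * b\<rfloor>}. of_int \<lfloor>\<alpha> * of_int x + real k * \<beta>\<rfloor> + 1 / 2) =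
      A * (real k)\<^sup>2 + (g k + sawtooth (real k * b) * (\<alpha> * b + \<beta>)
        - sawtooth (real k * a) * (\<alpha> * a + \<beta>)) * real k + g\<^sub>0 k"
    using slab_sum [OF assms(1-5)] by blast
  have "edge_sum u a b k =
      (\<Sum>x\<in>{\<lfloor>real k * a\<rfloor> + 1..\<lfloor>real k * b\<rfloor>}. of_int \<lfloor>\<alpha> * of_int x + real k * \<beta>\<rfloor> + 1 / 2)" for k
    unfolding edge_sum_def
  proof (intro sum.cong refl)
    fix x assume x: "x \<in> {\<lfloor>real k * a\<rfloor> + 1..\<lfloor>real k * b\<rfloor>}"
    \<comment> \<open>For \<open>k = 0\<close> the range is empty, so the division by
      \<open>k\<close> is harmless.\<close>
    then have k: "k > 0" by (cases "k = 0") auto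
    from x have "real k * a \<le> of_int x" "of_int x \<le> real k * b"
      by (auto simp: add1_zle_eq floor_less_iff le_floor_iff)
    then have "real k * u (of_int x / real k) = \<alpha> * of_int x + real k * \<beta>"
      using k by (subst u) (auto simp: field_simps)
    then show "real_of_int \<lfloor>real k * u (of_int x / real k)\<rfloor> + 1 / 2 =
        of_int \<lfloor>\<alpha> * of_int x + real k * \<beta>\<rfloor> + 1 / 2" by simp
  qed
  with g eq show ?thesis
    unfolding edge_quasi_def using u [of a] u [of b] \<open>a \<le> b\<close> by auto
qed

lemma edge_quasi_trans:
  assumes "edge_quasi u a b" "edge_quasi u b c" "a \<le> b" "b \<le> c"
  shows "edge_quasi u a c"
proof -
  obtain A g g\<^sub>0 where 1: "balanced g" "periodic g\<^sub>0" "\<And>k. edge_sum u a b k = A * (real k)\<^sup>2 +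
        (g k + sawtooth (real k * b) * u b - sawtooth (real k * a) * u a) * real k + g\<^sub>0 k"
    using assms(1) unfolding edge_quasi_def by blast
  obtain B h h\<^sub>0 where 2: "balanced h" "periodic h\<^sub>0" "\<And>k. edge_sum u b c k = B * (real k)\<^sup>2 +
        (h k + sawtooth (real k * c) * u c - sawtooth (real k * b) * u b) * real k + h\<^sub>0 k"
    using assms(2) unfolding edge_quasi_def by blast
  have "edge_sum u a c k = edge_sum u a b k + edge_sum u b c k" for k
  proof -
    have "\<lfloor>real k * a\<rfloor> \<le> \<lfloor>real k * b\<rfloor>" "\<lfloor>real k * b\<rfloor> \<le> \<lfloor>real k * c\<rfloor>"
      using assms by (auto intro!: floor_mono mult_left_mono)
    then have "{\<lfloor>real k * a\<rfloor> + 1..\<lfloor>real k * c\<rfloor>} =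
        {\<lfloor>real k * a\<rfloor> + 1..\<lfloor>real k * b\<rfloor>} \<union> {\<lfloor>real k * b\<rfloor> + 1..\<lfloor>real k * c\<rfloor>}" by auto
    then show ?thesis
      unfolding edge_sum_def by (simp only:) (rule sum.union_disjoint; auto)
  qed
  then have "edge_sum u a c k = (A + B) * (real k)\<^sup>2 +
      ((g k + h k) + sawtooth (real k * c) * u c - sawtooth (real k * a) * u a) * real k + (g\<^sub>0 k + h\<^sub>0 k)" for k
    unfolding 1 2 by (simp add: algebra_simps)
  moreover have "balanced (\<lambda>k. g k + h k)" "periodic (\<lambda>k. g\<^sub>0 k + h\<^sub>0 k)"
    using 1 2 by (auto intro: balanced_add periodic_comp2)
  ultimately show ?thesis
    unfolding edge_quasi_def by blast
qed

text \<open>\<open>C\<close> holds the break points; when these are rational, the rational values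
  there make all slopes rational too.\<close>

definition rational_piecewise_affine :: "real set \<Rightarrow> (real \<Rightarrow> real) \<Rightarrow> bool" where
  "rational_piecewise_affine C u \<longleftrightarrow> (\<forall>c\<in>C. u c \<in> \<rat>) \<and>
     (\<forall>c\<in>C. \<forall>d\<in>C. c < d \<and> C \<inter> {c<..<d} = {} \<longrightarrow>
        (\<forall>x\<in>{c..d}. u x = u c + (u d - u c) / (d - c) * (x - c)))"

text \<open>Induction on the number of break points below \<open>t\<close>: the last one before
  \<open>t\<close> splits off a strip on which \<open>u\<close> is affine.\<close>

lemma edge_quasi_piecewise:
  assumes u: "rational_piecewise_affine C u" and C: "finite C" "C \<subseteq> \<rat>"
    and a: "a \<in> C" "\<And>c. c \<in> C \<Longrightarrow> a \<le> c" and "t \<in> C"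
  shows "edge_quasi u a t"
  using \<open>t \<in> C\<close>
proof (induction "card {c \<in> C. c < t}" arbitrary: t rule: less_induct)
  case less
  show ?case
  proof (cases "t = a")
    case True
    then show ?thesis by (simp add: edge_quasi_refl)
  next
    case False
    let ?L = "{c \<in> C. c < t}"
    have "a \<in> ?L" using a(1) a(2) [OF less.prems] False by auto
    define s where "s = Max ?L"
    have s: "s \<in> ?L" and max: "\<And>c. c \<in> ?L \<Longrightarrow> c \<le> s"
      unfolding s_def using \<open>a \<in> ?L\<close> C by (intro Max_in Max_ge; force)+
    have "{c \<in> C. c < s} \<subset> ?L" using s by auto
    then have "card {c \<in> C. c < s} < card ?L"
      using C by (intro psubset_card_mono) auto
    then have as: "edge_quasi u a s" using less.hyps s by auto
    have "C \<inter> {s<..<t} = {}" using max by force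
    then have eq: "u x = u s + (u t - u s) / (t - s) * (x - s)" if "s \<le> x" "x \<le> t" for x
      using u s less.prems that unfolding rational_piecewise_affine_def by auto
    define \<alpha> where "\<alpha> = (u t - u s) / (t - s)"
    have rat: "u s \<in> \<rat>" "u t \<in> \<rat>" "s \<in> \<rat>" "t \<in> \<rat>"
      using u s less.prems C unfolding rational_piecewise_affine_def by auto
    then have "\<alpha> \<in> \<rat>" by (simp add: \<alpha>_def)
    moreover from this rat have "u s - \<alpha> * s \<in> \<rat>" by simp
    moreover have "s \<le> t" using s by simp
    moreover have "u x = \<alpha> * x + (u s - \<alpha> * s)" if "s \<le> x" "x \<le> t" for x
      using eq [OF that] unfolding \<alpha>_def [symmetric] right_diff_distrib by linarith
    ultimately have "edge_quasi u s t"
      using edge_quasi_affine [of \<alpha> "u s - \<alpha> * s" s t u] rat by blast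
    with as show ?thesis
      by (rule edge_quasi_trans) (use s a in auto)
  qed
qed

subsection \<open>The upper boundary of a polygon\<close>

text \<open>Caratheodory's theorem in dimension at most one leaves two points, possibly
  equal.\<close>

lemma convex_hull_collinear_segment:
  fixes T :: "'a::euclidean_space set"
  assumes "p \<in> convex hull T" "aff_dim T \<le> 1"
  shows "\<exists>v\<in>T. \<exists>w\<in>T. p \<in> closed_segment v w"
proof -
  obtain S where S: "finite S" "S \<subseteq> T" "int (card S) \<le> 2" "p \<in> convex hull S"
    using assms by (auto simp: caratheodory_aff_dim [of T])
  then have "card S \<noteq> 0" by auto
  with S(3) have "card S = 1 \<or> card S = 2" by linarith
  then obtain v w where "S = {v, w}"
    by (metis card_1_singletonE card_2_iff insert_absorb2)
  then show ?thesis
    using S by (auto simp: segment_convex_hull)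
qed

text \<open>A supporting line at \<open>p\<close> cuts out a face, which is the hull of points of
  \<open>S\<close> on that line; the collinear case then applies to these.\<close>

lemma frontier_convex_hull_segment:
  fixes S :: "(real^2) set"
  assumes "finite S" "p \<in> convex hull S" "p \<notin> interior (convex hull S)"
  shows "\<exists>v\<in>S. \<exists>w\<in>S. p \<in> closed_segment v w"
proof (cases "aff_dim S \<le> 1")
  case True
  with assms show ?thesis by (rule_tac convex_hull_collinear_segment)
next
  case False
  \<comment> \<open>The hull is two-dimensional here, so a point outside the interior lies on the
    relative boundary, where a supporting hyperplane exists.\<close>
  then have "aff_dim (convex hull S) = int (DIM(real^2))"
    using aff_dim_le_DIM [of S] by (simp add: aff_dim_convex_hull)
  then have "rel_interior (convex hull S) = interior (convex hull S)"
    by (intro rel_interior_interior) (simp only: aff_dim_eq_full)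
  with assms(3) have "p \<notin> rel_interior (convex hull S)" by simp
  obtain a where "a \<noteq> 0" and a: "\<And>y. y \<in> convex hull S \<Longrightarrow> a \<bullet> p \<le> a \<bullet> y"
    and "\<And>y. y \<in> rel_interior (convex hull S) \<Longrightarrow> a \<bullet> p < a \<bullet> y"
    by (rule supporting_hyperplane_rel_boundary [OF convex_convex_hull assms(2) \<open>p \<notin> rel_interior _\<close>])
      (rule that)
  have "(convex hull S \<inter> {x. a \<bullet> x = a \<bullet> p}) face_of (convex hull S)"
    using a by (intro face_of_Int_supporting_hyperplane_ge) auto
  then obtain T where T: "T \<subseteq> S" "convex hull S \<inter> {x. a \<bullet> x = a \<bullet> p} = convex hull T"
    by (rule face_of_convex_hull_subset [OF finite_imp_compact [OF assms(1)]])
  then have "T \<subseteq> {x. a \<bullet> x = a \<bullet> p}"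
    using hull_subset [of T convex] by blast
  then have "aff_dim T \<le> 1"
    using aff_dim_subset [of T "{x. a \<bullet> x = a \<bullet> p}"] aff_dim_hyperplane [OF \<open>a \<noteq> 0\<close>, of "a \<bullet> p"] by simp
  moreover have "p \<in> convex hull T"
    using T assms by auto
  ultimately show ?thesis
    using convex_hull_collinear_segment T by blast
qed

lemma vector_2_collapse: "vector [v $ 1, v $ 2] = (v :: 'a::zero^2)"
  by (simp add: vec_eq_iff forall_2)

lemma convex_chord_mem:
  assumes "convex P" "vector [a, s] \<in> P" "vector [b, t] \<in> P" "a < b" "a \<le> x" "x \<le> b"
  shows "(vector [x, s + (t - s) / (b - a) * (x - a)] :: real^2) \<in> P"
proof -
  define \<mu> where "\<mu> = (x - a) / (b - a)"
  have \<mu>: "0 \<le> \<mu>" "\<mu> \<le> 1" "x = a + \<mu> * (b - a)"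
    using assms by (auto simp: \<mu>_def)
  have "vector [x, s + (t - s) / (b - a) * (x - a)] =
      (1 - \<mu>) *\<^sub>R (vector [a, s] :: real^2) + \<mu> *\<^sub>R vector [b, t]"
  proof -
    have "(t - s) / (b - a) * (x - a) = \<mu> * (t - s)" by (simp add: \<mu>_def)
    then show ?thesis unfolding \<open>(t - s) / (b - a) * (x - a) = \<mu> * (t - s)\<close>
      using \<mu>(3) by (simp add: vec_eq_iff forall_2 algebra_simps)
  qed
  then show ?thesis
    using convexD_alt [OF assms(1-3) \<mu>(1,2)] by simp
qed

text \<open>Over an empty column the supremum carries no information, so the results on
  \<open>upper\<close> are obtained with a point of the column at hand.\<close>

definition upper :: "(real^2) set \<Rightarrow> real \<Rightarrow> real" where
  "upper P x = Sup {y. vector [x, y] \<in> P}"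

lemma upper_compact:
  assumes "compact P" "vector [x, y] \<in> P"
  shows upper_mem: "vector [x, upper P x] \<in> P" and upper_ge: "y \<le> upper P x"
proof -
  let ?Y = "{y. vector [x, y] \<in> P}"
  have Y: "?Y = (\<lambda>v. v $ 2) ` (P \<inter> {v. v $ 1 = x})"
    by (force simp: image_iff vector_2_collapse)
  have "compact (P \<inter> {v. v $ 1 = x})"
    by (intro compact_Int_closed assms closed_Collect_eq continuous_intros)
  then have "compact ?Y"
    unfolding Y by (intro compact_continuous_image continuous_intros)
  then have "closed ?Y" "bdd_above ?Y"
    by (auto intro: compact_imp_closed bounded_imp_bdd_above compact_imp_bounded)
  moreover have "y \<in> ?Y" using assms by simp
  ultimately have "Sup ?Y \<in> ?Y"
    by (intro closed_contains_Sup) auto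
  then show "vector [x, upper P x] \<in> P" "y \<le> upper P x"
    using \<open>y \<in> ?Y\<close> \<open>bdd_above ?Y\<close> by (auto simp: upper_def intro: cSup_upper)
qed

text \<open>The top of a column is not an interior point, so it lies on a segment between two points
  of \<open>S\<close>, which may be swapped to order their first coordinates.\<close>

lemma upper_segment:
  assumes "finite S" and P: "P = convex hull S" and "vector [x, y] \<in> P"
  obtains v w t where "v \<in> S" "w \<in> S" "v $ 1 \<le> w $ 1" "0 \<le> t" "t \<le> 1"
    "x = (1 - t) * v $ 1 + t * w $ 1" "upper P x = (1 - t) * v $ 2 + t * w $ 2"
proof -
  note goal = that
  have "compact P" using assms by (simp add: finite_imp_compact_convex_hull)
  define p :: "real^2" where "p = vector [x, upper P x]"
  have "p \<in> P"
    unfolding p_def using upper_mem [OF \<open>compact P\<close> assms(3)] .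
  moreover have "p \<notin> interior P"
  proof
    assume "p \<in> interior P"
    then obtain e where e: "e > 0" "cball p e \<subseteq> P" by (auto simp: mem_interior_cball)
    \<comment> \<open>A point straight above \<open>p\<close> would still lie in \<open>P\<close>,
      against the maximality of \<open>upper P x\<close>.\<close>
    define q where "q = p + e *\<^sub>R axis 2 1"
    have "q \<in> cball p e" using e by (simp add: q_def dist_norm norm_axis_1)
    moreover have "q = vector [x, upper P x + e]"
      by (simp add: q_def p_def vec_eq_iff forall_2 axis_def)
    ultimately have "vector [x, upper P x + e] \<in> P" using e by auto
    from upper_ge [OF \<open>compact P\<close> this] e show False by simp
  qed
  ultimately obtain v w where vw: "v \<in> S" "w \<in> S" "p \<in> closed_segment v w"
    using frontier_convex_hull_segment [OF assms(1)] P by blast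
  have *: thesis if "v \<in> S" "w \<in> S" "p \<in> closed_segment v w" "v $ 1 \<le> w $ 1" for v w
  proof -
    from that(3) obtain t where "0 \<le> t" "t \<le> 1" "p = (1 - t) *\<^sub>R v + t *\<^sub>R w"
      by (auto simp: in_segment)
    moreover from this have "x = (1 - t) * v $ 1 + t * w $ 1" "upper P x = (1 - t) * v $ 2 + t * w $ 2"
      by (auto simp: p_def vec_eq_iff forall_2)
    ultimately show thesis using that(1,2,4) goal by blast
  qed
  show thesis
    using *[of v w] *[of w v] vw by (metis closed_segment_commute linear)
qed

text \<open>On a non-vertical segment the parameter \<open>t\<close> is determined by
  \<open>x\<close> and hence rational. On a vertical one the top has the height of one of the end
  points.\<close>

lemma upper_rational:
  assumes "finite S" and P: "P = convex hull S" and "vector [x, y] \<in> P" and "x \<in> \<rat>"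
    and S: "\<And>v i. v \<in> S \<Longrightarrow> v $ i \<in> \<rat>"
  shows "upper P x \<in> \<rat>"
proof -
  have "compact P" using assms by (simp add: finite_imp_compact_convex_hull)
  from upper_segment [OF assms(1-3)] obtain v w t where vw: "v \<in> S" "w \<in> S" "0 \<le> t" "t \<le> 1"
    and x: "x = (1 - t) * v $ 1 + t * w $ 1" and u: "upper P x = (1 - t) * v $ 2 + t * w $ 2"
    by blast
  show ?thesis
  proof (cases "v $ 1 = w $ 1")
    case True
    then have "v $ 1 = x" "w $ 1 = x" using x by (auto simp: algebra_simps)
    then have "v $ 2 \<le> upper P x" "w $ 2 \<le> upper P x"
      using vw upper_ge [OF \<open>compact P\<close>, of x] vector_2_collapse [of v] vector_2_collapse [of w]
      by (auto simp: P hull_inc)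
    moreover have "(1 - t) * (upper P x - v $ 2) + t * (upper P x - w $ 2) = 0"
      by (subst (1 2) u) (simp add: algebra_simps)
    ultimately have "(1 - t) * (upper P x - v $ 2) = 0" "t * (upper P x - w $ 2) = 0"
      using vw by (smt (verit) mult_nonneg_nonneg)+
    then have "upper P x = v $ 2 \<or> upper P x = w $ 2" by auto
    then show ?thesis using S vw by auto
  next
    case False
    then have "t = (x - v $ 1) / (w $ 1 - v $ 1)"
      using x by (simp add: field_simps)
    then have "t \<in> \<rat>" using S vw \<open>x \<in> \<rat>\<close> by simp
    then show ?thesis unfolding u using S vw by simp
  qed
qed

lemma convex_hull_column_nonempty:
  assumes "finite S" and v: "v \<in> S" "v $ 1 \<le> x" and w: "w \<in> S" "x \<le> w $ 1"
  shows "\<exists>y. (vector [x, y] :: real^2) \<in> convex hull S"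
proof (cases "v $ 1 < w $ 1")
  case True
  have "vector [v $ 1, v $ 2] \<in> convex hull S" "vector [w $ 1, w $ 2] \<in> convex hull S"
    using v w by (simp_all add: vector_2_collapse hull_inc)
  from convex_chord_mem [OF convex_convex_hull this True v(2) w(2)] show ?thesis ..
next
  case False
  then have "v $ 1 = x" using v w by simp
  then have "vector [x, v $ 2] \<in> convex hull S"
    using v vector_2_collapse [of v] by (simp add: hull_inc)
  then show ?thesis ..
qed

text \<open>The top above \<open>x\<close> lies on a segment between two points of \<open>S\<close>.
  No point of \<open>S\<close> lies over the open gap, so the segment spans the gap; lying below
  \<open>upper P\<close> at both ends of it, it bounds the top by the chord. Convexity of
  \<open>P\<close> gives the other inequality.\<close>

lemma upper_piecewise:
  assumes "finite S" and P: "P = convex hull S" and S: "\<And>v i. v \<in> S \<Longrightarrow> v $ i \<in> \<rat>"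
  shows "rational_piecewise_affine ((\<lambda>v. v $ 1) ` S) (upper P)"
  unfolding rational_piecewise_affine_def
proof (intro conjI ballI impI)
  fix c assume "c \<in> (\<lambda>v. v $ 1) ` S"
  then obtain v where v: "v \<in> S" "c = v $ 1" by auto
  then have "vector [c, v $ 2] \<in> P" by (simp add: vector_2_collapse P hull_inc)
  from upper_rational [OF assms(1,2) this _ S] S v show "upper P c \<in> \<rat>" by auto
next
  fix c d x
  assume c: "c \<in> (\<lambda>v. v $ 1) ` S" and d: "d \<in> (\<lambda>v. v $ 1) ` S"
    and cd: "c < d \<and> (\<lambda>v. v $ 1) ` S \<inter> {c<..<d} = {}" and x: "x \<in> {c..d}"
  have "compact P" "convex P" using assms by (simp_all add: finite_imp_compact_convex_hull)
  let ?l = "\<lambda>s t. s + (t - s) / (d - c) * (x - c)"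
  show "upper P x = ?l (upper P c) (upper P d)"
  proof (cases "x = c \<or> x = d")
    case True
    then show ?thesis using cd by auto
  next
    case False
    then have x: "c < x" "x < d" using x by auto
    obtain v' w' where "v' \<in> S" "c = v' $ 1" "w' \<in> S" "d = w' $ 1" using c d by blast
    then have "vector [c, v' $ 2] \<in> P" "vector [d, w' $ 2] \<in> P"
      by (simp_all add: vector_2_collapse P hull_inc)
    then have "vector [c, upper P c] \<in> P" "vector [d, upper P d] \<in> P"
      using upper_mem [OF \<open>compact P\<close>] by blast+
    then have mem: "vector [x, ?l (upper P c) (upper P d)] \<in> P"
      using x cd by (intro convex_chord_mem \<open>convex P\<close>) auto
    from upper_segment [OF assms(1,2) mem] obtain v w t where vw: "v \<in> S" "w \<in> S" "v $ 1 \<le> w $ 1" "0 \<le> t" "t \<le> 1"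
      and xt: "x = (1 - t) * v $ 1 + t * w $ 1" and u: "upper P x = (1 - t) * v $ 2 + t * w $ 2"
      by metis
    have xv: "x - v $ 1 = t * (w $ 1 - v $ 1)" "w $ 1 - x = (1 - t) * (w $ 1 - v $ 1)"
      using xt by (simp_all add: algebra_simps)
    have "t * (w $ 1 - v $ 1) \<ge> 0" "(1 - t) * (w $ 1 - v $ 1) \<ge> 0"
      using vw by (auto intro!: mult_nonneg_nonneg)
    then have "0 \<le> x - v $ 1" "0 \<le> w $ 1 - x" by (simp_all only: xv)
    then have xvw: "v $ 1 \<le> x" "x \<le> w $ 1" by simp_all
    moreover have "v $ 1 \<notin> {c<..<d}" "w $ 1 \<notin> {c<..<d}" using vw cd by blast+
    ultimately have le: "v $ 1 \<le> c" "d \<le> w $ 1" using x by auto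
    define m where "m = (w $ 2 - v $ 2) / (w $ 1 - v $ 1)"
    have lt: "v $ 1 < w $ 1" using le cd by linarith
    have vP: "vector [v $ 1, v $ 2] \<in> P" "vector [w $ 1, w $ 2] \<in> P"
      using vw by (simp_all add: vector_2_collapse P hull_inc)
    have line: "v $ 2 + m * (z - v $ 1) \<le> upper P z" if "v $ 1 \<le> z" "z \<le> w $ 1" for z
      using upper_ge [OF \<open>compact P\<close> convex_chord_mem [OF \<open>convex P\<close> vP lt that]] by (simp add: m_def)
    have "m * (x - v $ 1) = t * (w $ 2 - v $ 2)"
      using lt xv(1) by (simp add: m_def)
    then have "upper P x = v $ 2 + m * (x - v $ 1)"
      by (simp add: u algebra_simps)
    also have "\<dots> = ?l (v $ 2 + m * (c - v $ 1)) (v $ 2 + m * (d - v $ 1))"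
    proof -
      have "(m * (d - v $ 1) - m * (c - v $ 1)) / (d - c) = m"
        using cd by (simp flip: right_diff_distrib)
      then show ?thesis by (simp add: algebra_simps)
    qed
    \<comment> \<open>Interpolation is monotone in its end values, as the weights
      \<open>1 - \<mu>\<close> and \<open>\<mu>\<close> are nonnegative.\<close>
    also have "\<dots> \<le> ?l (upper P c) (upper P d)"
    proof -
      define \<mu> where "\<mu> = (x - c) / (d - c)"
      have l: "?l r s = (1 - \<mu>) * r + \<mu> * s" for r s
      proof -
        have "?l r s = r + (s - r) * \<mu>" by (simp add: \<mu>_def)
        then show ?thesis by (simp only:) (simp add: algebra_simps)
      qed
      have "0 \<le> \<mu>" "\<mu> \<le> 1" using x by (auto simp: \<mu>_def)
      then show ?thesis
        unfolding l using line [of c] line [of d] le cd by (intro add_mono mult_left_mono) auto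
    qed
    finally have "upper P x \<le> ?l (upper P c) (upper P d)" .
    moreover have "?l (upper P c) (upper P d) \<le> upper P x"
      using upper_ge [OF \<open>compact P\<close> mem] .
    ultimately show ?thesis by simp
  qed
qed

text \<open>The bottom of a polygon is the negated top of its mirror image, so the results on
  \<open>upper\<close> serve for both boundaries.\<close>

definition reflect :: "real^2 \<Rightarrow> real^2" where
  "reflect v = vector [v $ 1, - v $ 2]"

lemma reflect_nth [simp]: "reflect v $ 1 = v $ 1" "reflect v $ 2 = - v $ 2"
  by (simp_all add: reflect_def)

lemma linear_reflect: "linear reflect"
  by (rule linearI) (simp_all add: vec_eq_iff forall_2)

lemma vector_mem_reflect_iff: "vector [x, y] \<in> reflect ` P \<longleftrightarrow> vector [x, - y] \<in> P"
proof
  assume "vector [x, - y] \<in> P"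
  moreover have "vector [x, y] = reflect (vector [x, - y])" by (simp add: vec_eq_iff forall_2)
  ultimately show "vector [x, y] \<in> reflect ` P" by blast
next
  assume "vector [x, y] \<in> reflect ` P"
  then obtain v where v: "v \<in> P" "vector [x, y] = reflect v" by blast
  then have "vector [x, - y] = v" by (auto simp: vec_eq_iff forall_2)
  with v show "vector [x, - y] \<in> P" by simp
qed

text \<open>Compactness puts the bottom and the top of the column into \<open>P\<close>, and
  convexity fills the segment between them.\<close>

lemma column_iff:
  assumes "compact P" "convex P" "vector [x, z] \<in> P"
  shows "vector [x, y] \<in> P \<longleftrightarrow> - upper (reflect ` P) x \<le> y \<and> y \<le> upper P x"
proof -
  have R: "compact (reflect ` P)"
    using assms(1) linear_reflect by (intro compact_continuous_image linear_continuous_on linear_conv_bounded_linear [THEN iffD1])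
  have zR: "vector [x, - z] \<in> reflect ` P" using assms by (simp add: vector_mem_reflect_iff)
  show ?thesis
  proof
    assume y: "vector [x, y] \<in> P"
    then have "vector [x, - y] \<in> reflect ` P" by (simp add: vector_mem_reflect_iff)
    from upper_ge [OF R this] upper_ge [OF assms(1) y]
    show "- upper (reflect ` P) x \<le> y \<and> y \<le> upper P x" by linarith
  next
    let ?l = "- upper (reflect ` P) x" and ?u = "upper P x"
    assume y: "?l \<le> y \<and> y \<le> ?u"
    have l: "vector [x, ?l] \<in> P"
      using upper_mem [OF R zR] by (simp add: vector_mem_reflect_iff)
    have u: "vector [x, ?u] \<in> P" using upper_mem [OF assms(1,3)] .
    have "vector [x, y] \<in> closed_segment (vector [x, ?l] :: real^2) (vector [x, ?u])"
    proof -
      have "y \<in> closed_segment ?l ?u" using y by (simp add: closed_segment_eq_real_ivl)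
      then obtain t where "0 \<le> t" "t \<le> 1" "y = (1 - t) * ?l + t * ?u" by (auto simp: in_segment)
      then show ?thesis
        by (auto simp: in_segment vec_eq_iff forall_2 algebra_simps intro!: exI [of _ t])
    qed
    then show "vector [x, y] \<in> P"
      using closed_segment_subset [OF l u assms(2)] by blast
  qed
qed

subsection \<open>Ehrhart coefficients\<close>

text \<open>The lattice points of the dilate are fibred over their integral first coordinate, and
  each fibre is a block of consecutive integers.\<close>

lemma lattice_count_columns:
  assumes "finite S" "S \<noteq> {}" and P: "P = convex hull S"
  defines "x\<^sub>0 \<equiv> Min ((\<lambda>v. v $ 1) ` S)" and "x\<^sub>1 \<equiv> Max ((\<lambda>v. v $ 1) ` S)"
  shows "real (lattice_count P (real k)) = (\<Sum>x\<in>{\<lceil>real k * x\<^sub>0\<rceil>..\<lfloor>real k * x\<^sub>1\<rfloor>}.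
    of_int \<lfloor>real k * upper P (of_int x / real k)\<rfloor>
    + of_int \<lfloor>real k * upper (reflect ` P) (of_int x / real k)\<rfloor> + 1)"
proof (cases "k = 0")
  case True
  \<comment> \<open>The dilate is the origin alone; on the right there is the single column 0, which
    contributes 1.\<close>
  have "P \<noteq> {}" using assms by simp
  then have "(*\<^sub>R) (real k) ` P \<inter> int_lattice = {0}"
    using True by (auto simp: int_lattice_def image_iff)
  then show ?thesis using True by (simp add: lattice_count_def)
next
  case False
  then have k: "k > 0" by simp
  have PC: "compact P" "convex P" using assms by (simp_all add: finite_imp_compact_convex_hull)
  define u w where "u = upper P" and "w = upper (reflect ` P)"
  define X where "X = {\<lceil>real k * x\<^sub>0\<rceil>..\<lfloor>real k * x\<^sub>1\<rfloor>}"
  \<comment> \<open>The bottom, at height -kw, is rounded up, which gives the negated floor of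
    kw.\<close>
  define Y where "Y x = {- \<lfloor>real k * w (of_int x / real k)\<rfloor>..\<lfloor>real k * u (of_int x / real k)\<rfloor>}" for x :: int
  have X: "x \<in> X \<longleftrightarrow> x\<^sub>0 \<le> of_int x / real k \<and> of_int x / real k \<le> x\<^sub>1" for x
    using k by (simp add: X_def ceiling_le_iff le_floor_iff field_simps)
  have "x\<^sub>0 \<in> (\<lambda>v. v $ 1) ` S" "x\<^sub>1 \<in> (\<lambda>v. v $ 1) ` S"
    unfolding x\<^sub>0_def x\<^sub>1_def using assms(1,2) by (simp_all only: Min_in Max_in finite_imageI image_is_empty not_False_eq_True)
  then obtain p q where pq: "p \<in> S" "x\<^sub>0 = p $ 1" "q \<in> S" "x\<^sub>1 = q $ 1" by blast
  have "P \<subseteq> {v. x\<^sub>0 \<le> v $ 1} \<inter> {v. v $ 1 \<le> x\<^sub>1}"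
    unfolding P
  proof (rule hull_minimal)
    show "S \<subseteq> {v. x\<^sub>0 \<le> v $ 1} \<inter> {v. v $ 1 \<le> x\<^sub>1}"
      using assms(1) by (auto simp: x\<^sub>0_def x\<^sub>1_def)
    have "convex {v :: real^2. x\<^sub>0 \<le> axis 1 1 \<bullet> v}" "convex {v :: real^2. axis 1 1 \<bullet> v \<le> x\<^sub>1}"
      by (auto intro: convex_halfspace_le convex_halfspace_ge)
    then show "convex ({v. x\<^sub>0 \<le> v $ 1} \<inter> {v :: real^2. v $ 1 \<le> x\<^sub>1})"
      by (simp add: inner_axis' convex_Int)
  qed
  then have range: "x\<^sub>0 \<le> x" "x \<le> x\<^sub>1" if "vector [x, y] \<in> P" for x y
    using that by auto
  have column: "\<exists>z. vector [of_int x / real k, z] \<in> P" if "x \<in> X" for x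
    unfolding P using that by (intro convex_hull_column_nonempty [OF assms(1) pq(1) _ pq(3)]) (simp_all add: X pq)
  have Y: "y \<in> Y x \<longleftrightarrow> vector [of_int x / real k, of_int y / real k] \<in> P" if x: "x \<in> X" for x y
  proof -
    obtain z where z: "vector [of_int x / real k, z] \<in> P" using column [OF x] ..
    have "y \<in> Y x \<longleftrightarrow> - real_of_int y \<le> real k * w (of_int x / real k) \<and> real_of_int y \<le> real k * u (of_int x / real k)"
      unfolding Y_def by (auto simp: le_floor_iff minus_le_iff)
    then show ?thesis
      unfolding column_iff [OF PC z] u_def [symmetric] w_def [symmetric] using k by (auto simp: field_simps)
  qed
  have "(*\<^sub>R) (real k) ` P \<inter> int_lattice =
      (\<lambda>(x, y). vector [of_int x, of_int y]) ` Sigma X Y" (is "?L = ?f ` _")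
  proof (intro set_eqI iffI)
    fix z assume "z \<in> ?L"
    then obtain p where p: "p \<in> P" "z = real k *\<^sub>R p" and z: "z $ 1 \<in> \<int>" "z $ 2 \<in> \<int>"
      by (auto simp: int_lattice_def)
    from z obtain x y where xy: "z $ 1 = of_int x" "z $ 2 = of_int y"
      by (auto elim!: Ints_cases)
    have "vector [of_int x / real k, of_int y / real k] = p"
      using k xy by (simp add: p vec_eq_iff forall_2 field_simps)
    then have m: "vector [of_int x / real k, of_int y / real k] \<in> P" using p by simp
    then have "x \<in> X" using range X by blast
    then have "(x, y) \<in> Sigma X Y" using Y m by simp
    moreover have "z = ?f (x, y)" using xy by (simp add: vec_eq_iff forall_2)
    ultimately show "z \<in> ?f ` Sigma X Y" by blast
  next
    fix z assume "z \<in> ?f ` Sigma X Y"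
    then obtain x y where xy: "x \<in> X" "y \<in> Y x" and z: "z = vector [of_int x, of_int y]" by auto
    then have "vector [of_int x / real k, of_int y / real k] \<in> P" using Y by blast
    moreover have "z = real k *\<^sub>R vector [of_int x / real k, of_int y / real k]"
      using k by (simp add: z vec_eq_iff forall_2)
    ultimately show "z \<in> ?L" by (auto simp: int_lattice_def z forall_2)
  qed
  moreover have "inj_on ?f (Sigma X Y)"
    by (auto simp: inj_on_def vec_eq_iff forall_2)
  moreover have "finite X" "\<And>x. finite (Y x)" by (simp_all add: X_def Y_def)
  ultimately have "lattice_count P (real k) = (\<Sum>x\<in>X. card (Y x))"
    by (simp add: lattice_count_def card_image card_SigmaI)
  also have "real \<dots> = (\<Sum>x\<in>X. of_int \<lfloor>real k * u (of_int x / real k)\<rfloor>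
      + of_int \<lfloor>real k * w (of_int x / real k)\<rfloor> + 1)"
    unfolding of_nat_sum
  proof (intro sum.cong refl)
    fix x assume "x \<in> X"
    then obtain z where z: "vector [of_int x / real k, z] \<in> P" using column by blast
    then have "- w (of_int x / real k) \<le> u (of_int x / real k)"
      using column_iff [OF PC z, of z] by (simp add: u_def w_def)
    then have "real k * - w (of_int x / real k) \<le> real k * u (of_int x / real k)"
      using k by (intro mult_left_mono) auto
    \<comment> \<open>A column may miss the lattice; since its length is nonnegative, the floors sum
      to at least -1 and the count is not truncated at 0.\<close>
    then have "0 \<le> \<lfloor>real k * u (of_int x / real k)\<rfloor> + \<lfloor>real k * w (of_int x / real k)\<rfloor> + 1"
      by linarith
    then show "real (card (Y x)) = of_int \<lfloor>real k * u (of_int x / real k)\<rfloor>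
      + of_int \<lfloor>real k * w (of_int x / real k)\<rfloor> + 1"
      by (simp add: Y_def)
  qed
  finally show ?thesis by (simp add: X_def u_def w_def)
qed

lemma balanced_sawtooth:
  assumes "b \<in> \<rat>" "s \<ge> 0"
  shows "balanced (\<lambda>k. sawtooth (real k * b) * s)"
  unfolding balanced_def
proof (intro conjI allI)
  show "periodic (\<lambda>k. sawtooth (real k * b) * s)"
    by (rule periodic_comp [OF periodic_sawtooth [OF assms(1)]])
  show "\<bar>sawtooth (real k * b) * s\<bar> \<le> sawtooth (real 0 * b) * s" for k
    using mult_right_mono [OF abs_sawtooth_le assms(2), of "real k * b"] assms(2) by (simp add: abs_mult)
qed

text \<open>Top and bottom are summed over the half-open range of columns; the remaining sawtooth
  terms are weighted by the lengths of the leftmost and rightmost vertical sections. The left one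
  has the wrong sign, and the column on the left end, which the range excludes, corrects exactly
  this.\<close>

lemma is_ehrhart_coeffs_exists:
  fixes S :: "(real^2) set"
  assumes fin: "finite S" "S \<noteq> {}" and S: "\<And>v i. v \<in> S \<Longrightarrow> v $ i \<in> \<rat>"
  shows "\<exists>G. is_ehrhart_coeffs (convex hull S) G \<and> (\<forall>k. \<bar>G 1 k\<bar> \<le> G 1 0)"
proof -
  define P where "P = convex hull S"
  define C where "C = (\<lambda>v. v $ 1) ` S"
  define x\<^sub>0 x\<^sub>1 where "x\<^sub>0 = Min C" and "x\<^sub>1 = Max C"
  define u w where "u = upper P" and "w = upper (reflect ` P)"
  have C: "finite C" "C \<subseteq> \<rat>" "C \<noteq> {}" using fin S by (auto simp: C_def)
  then have x: "x\<^sub>0 \<in> C" "x\<^sub>1 \<in> C" "\<And>c. c \<in> C \<Longrightarrow> x\<^sub>0 \<le> c"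
    by (auto simp: x\<^sub>0_def x\<^sub>1_def)
  have R: "reflect ` P = convex hull (reflect ` S)"
    by (simp add: P_def convex_hull_linear_image linear_reflect)
  have CR: "(\<lambda>v. v $ 1) ` reflect ` S = C" by (force simp: C_def image_image)
  have SR: "v $ i \<in> \<rat>" if "v \<in> reflect ` S" for v i
    using that S exhaust_2 [of i] by auto
  have u: "rational_piecewise_affine C u" and w: "rational_piecewise_affine C w"
    using upper_piecewise [OF fin(1) P_def S] upper_piecewise [OF finite_imageI [OF fin(1)] R SR]
    by (simp_all add: u_def w_def CR C_def)
  obtain A g g\<^sub>0 where g: "balanced g" "periodic g\<^sub>0" "\<And>k. edge_sum u x\<^sub>0 x\<^sub>1 k = A * (real k)\<^sup>2 +
        (g k + sawtooth (real k * x\<^sub>1) * u x\<^sub>1 - sawtooth (real k * x\<^sub>0) * u x\<^sub>0) * real k + g\<^sub>0 k"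
    using edge_quasi_piecewise [OF u C(1,2) x(1,3,2)] unfolding edge_quasi_def by blast
  obtain B h h\<^sub>0 where h: "balanced h" "periodic h\<^sub>0" "\<And>k. edge_sum w x\<^sub>0 x\<^sub>1 k = B * (real k)\<^sup>2 +
        (h k + sawtooth (real k * x\<^sub>1) * w x\<^sub>1 - sawtooth (real k * x\<^sub>0) * w x\<^sub>0) * real k + h\<^sub>0 k"
    using edge_quasi_piecewise [OF w C(1,2) x(1,3,2)] unfolding edge_quasi_def by blast
  \<comment> \<open>The length of the vertical section over \<open>c\<close>.\<close>
  define s where "s c = u c + w c" for c
  have s: "s c \<ge> 0" if c: "c \<in> C" for c
  proof -
    obtain v where "v \<in> S" "c = v $ 1" using c by (auto simp: C_def)
    then have z: "vector [c, v $ 2] \<in> P" by (simp add: vector_2_collapse P_def hull_inc)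
    have "compact P" "convex P" using fin by (simp_all add: P_def finite_imp_compact_convex_hull)
    from column_iff [OF this z, of "v $ 2"] z show ?thesis by (simp add: s_def u_def w_def)
  qed
  \<comment> \<open>By \<open>sawtooth_minus\<close> this is 1 if \<open>real k * x\<^sub>0\<close>
    is an integer, so that a lattice column sits on the left end, and 0 otherwise.\<close>
  define \<iota> where "\<iota> k = sawtooth (real k * x\<^sub>0) + sawtooth (real k * - x\<^sub>0)" for k
  \<comment> \<open>The excluded column adds \<open>\<iota> k * s x\<^sub>0\<close> to the linear
    coefficient, and \<open>\<iota> k - sawtooth (real k * x\<^sub>0)\<close> is the last sawtooth
    value here.\<close>
  define G\<^sub>1 where "G\<^sub>1 k = ((g k + h k) + sawtooth (real k * x\<^sub>1) * s x\<^sub>1) + sawtooth (real k * - x\<^sub>0) * s x\<^sub>0" for k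
  define G\<^sub>0 where "G\<^sub>0 k = (g\<^sub>0 k + h\<^sub>0 k) + \<iota> k * (sawtooth (real k * u x\<^sub>0) + sawtooth (real k * w x\<^sub>0))" for k
  have rat: "x\<^sub>0 \<in> \<rat>" "x\<^sub>1 \<in> \<rat>" "u x\<^sub>0 \<in> \<rat>" "w x\<^sub>0 \<in> \<rat>"
    using x C u w by (auto simp: rational_piecewise_affine_def)
  have "balanced G\<^sub>1"
    unfolding G\<^sub>1_def using g h x s rat by (intro balanced_add balanced_sawtooth) auto
  have "periodic \<iota>"
    unfolding \<iota>_def using rat by (intro periodic_comp2 [where h = "(+)"] periodic_sawtooth) auto
  then have "periodic G\<^sub>0"
    unfolding G\<^sub>0_def using g h rat
    by (intro periodic_comp2 [where h = "(+)"] periodic_comp2 [where h = "(*)"] periodic_sawtooth) auto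
  have count: "real (lattice_count P (real k)) = (A + B) * (real k)\<^sup>2 + G\<^sub>1 k * real k + G\<^sub>0 k" for k
  proof -
    define f where "f x = real_of_int \<lfloor>real k * u (of_int x / real k)\<rfloor>
      + of_int \<lfloor>real k * w (of_int x / real k)\<rfloor> + 1" for x :: int
    have "real (lattice_count P (real k)) = (\<Sum>x\<in>{\<lceil>real k * x\<^sub>0\<rceil>..\<lfloor>real k * x\<^sub>1\<rfloor>}. f x)"
      using lattice_count_columns [OF fin P_def, of k] by (simp add: f_def x\<^sub>0_def x\<^sub>1_def C_def u_def w_def)
    also have "\<dots> = (\<Sum>x\<in>{\<lfloor>real k * x\<^sub>0\<rfloor> + 1..\<lfloor>real k * x\<^sub>1\<rfloor>}. f x)
        + \<iota> k * (of_int \<lfloor>real k * u x\<^sub>0\<rfloor> + of_int \<lfloor>real k * w x\<^sub>0\<rfloor> + 1)"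
    proof (cases "real k * x\<^sub>0 \<in> \<int>")
      case True
      then obtain m where m: "real k * x\<^sub>0 = of_int m" by (auto elim: Ints_cases)
      have "real k * x\<^sub>0 \<le> real k * x\<^sub>1" using x by (intro mult_left_mono) auto
      then have "m \<le> \<lfloor>real k * x\<^sub>1\<rfloor>" by (simp add: m le_floor_iff)
      then have "{\<lceil>real k * x\<^sub>0\<rceil>..\<lfloor>real k * x\<^sub>1\<rfloor>} = insert m {\<lfloor>real k * x\<^sub>0\<rfloor> + 1..\<lfloor>real k * x\<^sub>1\<rfloor>}"
        unfolding m by auto
      moreover have "m \<notin> {\<lfloor>real k * x\<^sub>0\<rfloor> + 1..\<lfloor>real k * x\<^sub>1\<rfloor>}" by (simp add: m)
      moreover have "f m = of_int \<lfloor>real k * u x\<^sub>0\<rfloor> + of_int \<lfloor>real k * w x\<^sub>0\<rfloor> + 1"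
        by (cases "k = 0") (simp_all add: f_def flip: m)
      moreover have "\<iota> k = 1" using True by (simp add: \<iota>_def sawtooth_minus)
      ultimately show ?thesis by simp
    next
      case False
      then have "\<lceil>real k * x\<^sub>0\<rceil> = \<lfloor>real k * x\<^sub>0\<rfloor> + 1"
        by (metis Ints_of_int ceiling_altdef)
      moreover have "\<iota> k = 0" using False by (simp add: \<iota>_def sawtooth_minus)
      ultimately show ?thesis by simp
    qed
    also have "(\<Sum>x\<in>{\<lfloor>real k * x\<^sub>0\<rfloor> + 1..\<lfloor>real k * x\<^sub>1\<rfloor>}. f x) = edge_sum u x\<^sub>0 x\<^sub>1 k + edge_sum w x\<^sub>0 x\<^sub>1 k"
      unfolding edge_sum_def f_def by (simp flip: sum.distrib) (simp add: algebra_simps)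
    finally show ?thesis
      unfolding g h floor_eq_sawtooth G\<^sub>1_def G\<^sub>0_def s_def \<iota>_def by (simp add: algebra_simps)
  qed
  define G where "G i k = (if i = 2 then A + B else if i = 1 then G\<^sub>1 k else if i = 0 then G\<^sub>0 k else 0)" for i k :: nat
  have "is_ehrhart_coeffs P G"
    unfolding is_ehrhart_coeffs_def
  proof (intro conjI allI impI)
    fix i
    have "periodic (G i)"
      unfolding G_def using \<open>balanced G\<^sub>1\<close> \<open>periodic G\<^sub>0\<close>
      by (cases "i = 2"; cases "i = 1"; cases "i = 0") (simp_all add: balanced_def)
    then show "\<exists>p>0. \<forall>k. G i (k + p) = G i k" by (simp add: periodic_def)
  next
    fix i k assume "i > CARD(2)"
    then show "G i k = 0" by (simp add: G_def)
  next
    fix k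
    show "real (lattice_count P (real k)) = (\<Sum>i\<le>CARD(2). G i k * real k ^ i)"
      unfolding count by (simp add: G_def numeral_2_eq_2)
  qed
  moreover have "\<forall>k. \<bar>G 1 k\<bar> \<le> G 1 0" using \<open>balanced G\<^sub>1\<close> by (simp add: G_def balanced_def)
  ultimately show ?thesis unfolding P_def by blast
qed

section \<open>Uniqueness of the coefficients and their behaviour under dilation\<close>

lemma periodic_common_period:
  assumes "finite I" "\<And>i. i \<in> I \<Longrightarrow> periodic (H i)"
  shows "\<exists>p>0. \<forall>i\<in>I. \<forall>k. H i (k + p) = H i k"
  using assms
proof (induction I rule: finite_induct)
  case empty
  then show ?case by auto
next
  case (insert j I)
  then obtain p where p: "p > 0" "\<And>i k. i \<in> I \<Longrightarrow> H i (k + p) = H i k" by auto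
  obtain q where q: "q > 0" "\<And>k. H j (k + q) = H j k"
    using insert.prems [of j] by (auto simp: periodic_def)
  have "H i (k + p * q) = H i k" if "i \<in> insert j I" for i k
    using that periodic_add_mult [of "H i" p k q] periodic_add_mult [of "H j" q k p] p q
    by (auto simp: mult.commute)
  then show ?case using p q by (intro exI [of _ "p * q"]) auto
qed

text \<open>Along k, k + p, k + 2p, ... with a common period \<open>p\<close> the differences of the
  coefficients are constant, so they are the coefficients of a polynomial with infinitely many
  roots.\<close>

lemma is_ehrhart_coeffs_unique:
  fixes P :: "(real^'n) set"
  assumes "is_ehrhart_coeffs P G" "is_ehrhart_coeffs P G'"
  shows "G = G'"
proof (intro ext)
  fix i k
  let ?n = "CARD('n)"
  define H where "H i k = G i k - G' i k" for i k
  have "periodic (G i)" "periodic (G' i)" for i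
    using assms by (auto simp: is_ehrhart_coeffs_def periodic_def)
  then have "periodic (H i)" for i
    unfolding H_def by (rule periodic_comp2)
  then obtain p where p: "p > 0" "\<And>i k. i \<le> ?n \<Longrightarrow> H i (k + p) = H i k"
    using periodic_common_period [of "{..?n}" H] by auto
  have "(\<Sum>i\<le>?n. H i k * real k ^ i) = 0" for k
    using assms by (simp add: is_ehrhart_coeffs_def H_def left_diff_distrib sum_subtractf)
  then have "(\<Sum>i\<le>?n. H i k * real (k + m * p) ^ i) = 0" for m
    using periodic_add_mult [of "H _" p k m] p
    by (metis (mono_tags, lifting) atMost_iff sum.cong)
  then have "range (\<lambda>m. real (k + m * p)) \<subseteq> {z. (\<Sum>i\<le>?n. H i k * z ^ i) = 0}" by blast
  moreover have "infinite (range (\<lambda>m. real (k + m * p)))"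
    using p by (intro range_inj_infinite) (auto simp: inj_on_def)
  ultimately have "infinite {z. (\<Sum>i\<le>?n. H i k * z ^ i) = 0}"
    using infinite_super by blast
  then have "H i k = 0" if "i \<le> ?n"
    using polyfun_finite_roots [of "\<lambda>i. H i k" ?n] that by auto
  moreover have "G i k = 0" "G' i k = 0" if "i > ?n"
    using assms that by (auto simp: is_ehrhart_coeffs_def)
  ultimately show "G i k = G' i k"
    unfolding H_def by (cases "i \<le> ?n") auto
qed

lemma ehrhart_coeff_eq: "is_ehrhart_coeffs P G \<Longrightarrow> ehrhart_coeff i P = G i"
  unfolding ehrhart_coeff_def by (metis is_ehrhart_coeffs_unique the_equality)

text \<open>The \<open>k\<close>-th dilate of bP is the bk-th dilate of \<open>P\<close>; expanding
  the power of bk moves the factor \<open>b ^ i\<close> into the coefficient.\<close>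

lemma is_ehrhart_coeffs_dilate:
  fixes P :: "(real^'n) set"
  assumes G: "is_ehrhart_coeffs P G"
  shows "is_ehrhart_coeffs ((*\<^sub>R) (real b) ` P) (\<lambda>i k. real b ^ i * G i (b * k))"
  unfolding is_ehrhart_coeffs_def
proof (intro conjI allI impI)
  fix i
  have "periodic (G i)" using G by (simp add: is_ehrhart_coeffs_def periodic_def)
  from periodic_comp [OF periodic_dilate [OF this]]
  have "periodic (\<lambda>k. real b ^ i * G i (b * k))" .
  then show "\<exists>p>0. \<forall>k. real b ^ i * G i (b * (k + p)) = real b ^ i * G i (b * k)"
    unfolding periodic_def .
next
  fix i k assume "i > CARD('n)"
  then show "real b ^ i * G i (b * k) = 0" using G by (simp add: is_ehrhart_coeffs_def)
next
  fix k
  have "lattice_count ((*\<^sub>R) (real b) ` P) (real k) = lattice_count P (real (b * k))"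
    by (simp add: lattice_count_def image_image mult.commute)
  also have "real \<dots> = (\<Sum>i\<le>CARD('n). G i (b * k) * real (b * k) ^ i)"
    using G unfolding is_ehrhart_coeffs_def by blast
  finally show "real (lattice_count ((*\<^sub>R) (real b) ` P) (real k)) =
      (\<Sum>i\<le>CARD('n). real b ^ i * G i (b * k) * real k ^ i)"
    by (simp add: power_mult_distrib mult_ac)
qed

theorem theorem1p8:
  fixes P :: "(real^2) set" and r :: rat
  assumes "rational_polytope P"
    and "aff_dim P = 2"
    and "0 \<le> r"
    and "r < rat_denominator P"
  shows "\<bar>rat_ehrhart_coeff 1 P r\<bar> \<le> rat_ehrhart_coeff 1 P 0"
proof -
  define V where "V = {v. v extreme_point_of P}"
  have "polytope P" using assms by (simp add: rational_polytope_def)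
  then have V: "finite V" "P = convex hull V"
    using finite_polyhedron_extreme_points [of P] Krein_Milman_Minkowski [of P]
    by (simp_all add: V_def polytope_imp_polyhedron polytope_imp_compact polytope_imp_convex)
  \<comment> \<open>The empty hull has dimension -1, not 2.\<close>
  have "V \<noteq> {}" using V assms by auto
  obtain a b where ab: "quotient_of r = (a, b)" by fastforce
  then have "b > 0" by (rule quotient_of_denom_pos)
  define n where "n = nat b"
  have n: "n > 0" "real_of_int b = real n" using \<open>b > 0\<close> by (simp_all add: n_def)
  \<comment> \<open>One family of coefficients, that of \<open>Q\<close>, governs both sides:
    directly for \<open>r\<close>, and for 0 through \<open>P\<close> as the \<open>n\<close>-fold
    dilate of \<open>Q\<close>.\<close>
  define Q where "Q = (*\<^sub>R) (1 / real n) ` P"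
  have Q: "Q = convex hull ((*\<^sub>R) (1 / real n) ` V)"
    by (simp only: Q_def V(2) convex_hull_scaling)
  have "v $ i \<in> \<rat>" if "v \<in> (*\<^sub>R) (1 / real n) ` V" for v i
    using that assms by (auto simp: V_def rational_polytope_def)
  then obtain G where G: "is_ehrhart_coeffs Q G" "\<And>k. \<bar>G 1 k\<bar> \<le> G 1 0"
    using is_ehrhart_coeffs_exists [of "(*\<^sub>R) (1 / real n) ` V"] V \<open>V \<noteq> {}\<close> Q by auto
  have "P = (*\<^sub>R) (real n) ` Q" using n by (simp add: Q_def image_image)
  then have "ehrhart_coeff 1 P = (\<lambda>k. real n ^ 1 * G 1 (n * k))"
    using ehrhart_coeff_eq [OF is_ehrhart_coeffs_dilate [OF G(1), of n], of 1] by simp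
  \<comment> \<open>In lowest terms 0 is 0/1, so here the coefficient of \<open>P\<close> itself is
    evaluated.\<close>
  then have "rat_ehrhart_coeff 1 P 0 = real n * G 1 0"
    by (simp add: rat_ehrhart_coeff_def)
  moreover have "rat_ehrhart_coeff 1 P r = real n * G 1 (nat a)"
    using ehrhart_coeff_eq [OF G(1), of 1] by (simp add: rat_ehrhart_coeff_def ab n Q_def)
  ultimately show ?thesis
    using G(2) by (simp add: abs_mult mult_left_mono)
qed

end
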